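(* For every positive integer $n$, $$\lfloor\log_2 n\rfloor + \tfrac{1}{4}\sqrt{\lfloor\log_2 n\rfloor}-1 < \chi'_{2K_2}(n)\leq 2\lceil\sqrt{n}\rceil-2.$$
   Context: For a graph $G$ and a set $\mathcal H$ of small graphs, an $\mathcal H$-avoiding bipartite partition of $G$ is a collection of bipartite graphs $G_1,\dots,G_k$ (subgraphs of $G$) whose edge sets are pairwise disjoint with union $E(G)$, such that no $G_i$ contains any member of $\mathcal H$ as an induced subgraph. $\chi'_{\mathcal H}(G)$ is the smallest $k$ for which such a partition with $k$ graphs exists, and $\chi'_{\mathcal H}(n):=\chi'_{\mathcal H}(K_n)$, where $K_n$ is the complete graph on $n$ vertices. When $\mathcal H=\{H\}$ one writes $\chi'_H$. Here $2K_2$ denotes the disjoint union of two edges (a graph on 4 vertices with two disjoint edges). Equivalently, the bipartite graphs containing no induced $2K_2$ are exactly the Ferrers graphs: bipartite graphs with a color class $A$ admitting an ordering $a_1,\dots,a_m$ with $N(a_1)\subseteq N(a_2)\subseteq\dots\subseteq N(a_m)$. *)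

theory Defs
  imports Complex_Main
begin

record 'a sgraph =
  verts :: "'a set"
  edges :: "'a set set"

definition simple_graph :: "'a sgraph \<Rightarrow> bool" where
  "simple_graph G \<longleftrightarrow> (\<forall>e\<in>edges G. e \<subseteq> verts G \<and> card e = 2)"

definition subgraph :: "'a sgraph \<Rightarrow> 'a sgraph \<Rightarrow> bool" where
  "subgraph G' G \<longleftrightarrow> simple_graph G' \<and> verts G' \<subseteq> verts G \<and> edges G' \<subseteq> edges G"

definition bipartite :: "'a sgraph \<Rightarrow> bool" where
  "bipartite G \<longleftrightarrow> (\<exists>A B. A \<union> B = verts G \<and> A \<inter> B = {} \<and>
      (\<forall>e\<in>edges G. \<exists>a\<in>A. \<exists>b\<in>B. e = {a, b}))"

definition induced :: "'a sgraph \<Rightarrow> 'a set \<Rightarrow> 'a sgraph" where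
  "induced G U = \<lparr>verts = U, edges = {e \<in> edges G. e \<subseteq> U}\<rparr>"

definition graph_iso :: "'a sgraph \<Rightarrow> 'b sgraph \<Rightarrow> bool" where
  "graph_iso G H \<longleftrightarrow> (\<exists>f. bij_betw f (verts G) (verts H) \<and>
      (\<forall>u\<in>verts G. \<forall>v\<in>verts G. {u, v} \<in> edges G \<longleftrightarrow> {f u, f v} \<in> edges H))"

definition contains_induced :: "'a sgraph \<Rightarrow> 'b sgraph \<Rightarrow> bool" where
  "contains_induced G H \<longleftrightarrow> (\<exists>U\<subseteq>verts G. graph_iso H (induced G U))"

definition avoiding_bipartite_partition ::
    "'b sgraph set \<Rightarrow> 'a sgraph \<Rightarrow> nat \<Rightarrow> (nat \<Rightarrow> 'a sgraph) \<Rightarrow> bool" where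
  "avoiding_bipartite_partition \<H> G k P \<longleftrightarrow>
     (\<forall>i<k. subgraph (P i) G \<and> bipartite (P i)) \<and>
     (\<forall>i<k. \<forall>j<k. i \<noteq> j \<longrightarrow> edges (P i) \<inter> edges (P j) = {}) \<and>
     (\<Union>i<k. edges (P i)) = edges G \<and>
     (\<forall>i<k. \<forall>H\<in>\<H>. \<not> contains_induced (P i) H)"

text \<open>Only meaningful when some partition exists (for general families there may be none);
  \<open>ex_partition_2K2\<close> below shows that one does for complete graphs and \<open>2K\<^sub>2\<close>.\<close>

definition chi_index :: "'b sgraph set \<Rightarrow> 'a sgraph \<Rightarrow> nat" where
  "chi_index \<H> G = (LEAST k. \<exists>P. avoiding_bipartite_partition \<H> G k P)"

definition complete_graph :: "nat \<Rightarrow> nat sgraph" where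
  "complete_graph n = \<lparr>verts = {..<n}, edges = {e. e \<subseteq> {..<n} \<and> card e = 2}\<rparr>"

definition chi_index_complete :: "'b sgraph set \<Rightarrow> nat \<Rightarrow> nat" where
  "chi_index_complete \<H> n = chi_index \<H> (complete_graph n)"

definition two_K2 :: "nat sgraph" where
  "two_K2 = \<lparr>verts = {0, 1, 2, 3}, edges = {{0, 1}, {2, 3}}\<rparr>"

lemma not_contains_induced_single_edge:
  assumes "card e = 2"
  shows "\<not> contains_induced \<lparr>verts = e, edges = {e}\<rparr> two_K2"
proof
  assume "contains_induced \<lparr>verts = e, edges = {e}\<rparr> two_K2"
  then obtain U where U: "U \<subseteq> e" and "graph_iso two_K2 (induced \<lparr>verts = e, edges = {e}\<rparr> U)"
    by (auto simp: contains_induced_def)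
  then obtain f where "bij_betw f (verts two_K2) (verts (induced \<lparr>verts = e, edges = {e}\<rparr> U))"
    unfolding graph_iso_def by blast
  then have f: "bij_betw f {0, 1, 2, 3} U"
    by (simp add: two_K2_def induced_def)
  have "card U = 4" using bij_betw_same_card[OF f] by simp
  moreover have "finite e" using assms by (metis card.infinite zero_neq_numeral)
  ultimately show False using card_mono[OF _ U] assms by simp
qed

lemma ex_partition_2K2:
  "\<exists>k P. avoiding_bipartite_partition {two_K2} (complete_graph n) k P"
proof -
  let ?E = "edges (complete_graph n)"
  have "finite ?E"
    by (rule finite_subset[of _ "Pow {..<n}"]) (auto simp: complete_graph_def)
  then obtain g where g: "bij_betw g {0..<card ?E} ?E"
    using ex_bij_betw_nat_finite by blast
  have gE: "g i \<in> ?E" if "i < card ?E" for i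
    using g that by (auto simp: bij_betw_def)
  have inj: "i = j" if "i < card ?E" "j < card ?E" "g i = g j" for i j
    using g that by (auto simp: bij_betw_def inj_on_def)
  have img: "(\<Union>i<card ?E. {g i}) = ?E"
    using bij_betw_imp_surj_on[OF g] by (simp add: atLeast0LessThan UNION_singleton_eq_range)
  have bip: "bipartite \<lparr>verts = e, edges = {e}\<rparr>" if e: "card e = 2" for e :: "nat set"
  proof -
    obtain a b where "e = {a, b}" "a \<noteq> b" using e by (auto simp: card_2_iff)
    then show ?thesis unfolding bipartite_def
      by (intro exI[of _ "{a}"] exI[of _ "{b}"]) auto
  qed
  have c: "g i \<subseteq> {..<n}" "card (g i) = 2" if "i < card ?E" for i
    using gE[OF that] by (simp_all add: complete_graph_def)
  have "avoiding_bipartite_partition {two_K2} (complete_graph n) (card ?E)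
      (\<lambda>i. \<lparr>verts = g i, edges = {g i}\<rparr>)"
    unfolding avoiding_bipartite_partition_def
  proof (intro conjI)
    show "\<forall>i<card ?E. subgraph \<lparr>verts = g i, edges = {g i}\<rparr> (complete_graph n) \<and>
        bipartite \<lparr>verts = g i, edges = {g i}\<rparr>"
    proof (intro allI impI)
      fix i assume i: "i < card ?E"
      show "subgraph \<lparr>verts = g i, edges = {g i}\<rparr> (complete_graph n) \<and>
          bipartite \<lparr>verts = g i, edges = {g i}\<rparr>"
        using c[OF i] bip[OF c(2)[OF i]]
        by (simp add: subgraph_def simple_graph_def complete_graph_def)
    qed
    show "\<forall>i<card ?E. \<forall>j<card ?E. i \<noteq> j \<longrightarrow>
        edges \<lparr>verts = g i, edges = {g i}\<rparr> \<inter> edges \<lparr>verts = g j, edges = {g j}\<rparr> = {}"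
      using inj by fastforce
    show "(\<Union>i<card ?E. edges \<lparr>verts = g i, edges = {g i}\<rparr>) = ?E"
      using img by simp
    show "\<forall>i<card ?E. \<forall>H\<in>{two_K2}. \<not> contains_induced \<lparr>verts = g i, edges = {g i}\<rparr> H"
      using c(2) not_contains_induced_single_edge by blast
  qed
  then show ?thesis by blast
qed

end

theory Submission
  imports Defs "HOL-Analysis.Convex"
begin

text \<open>
  For the upper bound put the vertices on an \<open>m \<times> m\<close> grid, \<open>m = \<lceil>sqrt n\<rceil>\<close>. Column \<open>i\<close> is joined to
  the points strictly to its right and weakly above, row \<open>j\<close> to the points strictly above and
  weakly to the left; these \<open>2 (m - 1)\<close> Ferrers graphs partition the complete graph.

  For the lower bound, a Ferrers graph with \<open>e\<close> edges has a vertex cover of size at most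
  \<open>2 sqrt e\<close>, read off the Durfee square of its Ferrers diagram. Given a partition into \<open>k\<close> Ferrers
  graphs, let \<open>T v\<close> be the set of indices of the covers containing \<open>v\<close>. As the graphs are
  edge-disjoint, Cauchy--Schwarz bounds the average of \<open>card (T v)\<close> by \<open>sqrt (2 k)\<close>. The vertices
  with \<open>T v \<subseteq> R\<close> are pairwise separated by the bipartitions with index in \<open>R\<close>, so there are at most
  \<open>2 ^ card R\<close> of them. Summing over all \<open>R\<close> gives \<open>(\<Sum>v. 2 ^ (k - card (T v))) \<le> 3 ^ k\<close>, hence
  \<open>n \<le> (3/2) ^ k * 2 powr sqrt (2 k)\<close> by convexity, which is stronger than the claim for
  \<open>k \<ge> 16\<close>; for smaller \<open>k\<close> the bound \<open>n \<le> 2 ^ k\<close> suffices.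
\<close>

section \<open>Induced copies of two disjoint edges\<close>

lemma contains_induced_two_K2I:
  assumes "{a, b, c, d} \<subseteq> verts G" "distinct [a, b, c, d]"
    and "{a, b} \<in> edges G" "{c, d} \<in> edges G"
    and "{a, c} \<notin> edges G" "{a, d} \<notin> edges G" "{b, c} \<notin> edges G" "{b, d} \<notin> edges G"
    and "simple_graph G"
  shows "contains_induced G two_K2"
proof -
  define f where "f = (\<lambda>i::nat. if i = 0 then a else if i = 1 then b else if i = 2 then c else d)"
  \<comment> \<open>\<open>graph_iso\<close> also compares pairs with \<open>u = v\<close>, so
    singletons must be known to be non-edges.\<close>
  have loops: "{x} \<notin> edges G" for x
    using assms(9) by (force simp: simple_graph_def)
  have "bij_betw f {0, 1, 2, 3} {a, b, c, d}"
    using assms(2) by (auto simp: bij_betw_def f_def inj_on_def)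
  moreover have "{u, v} \<in> edges two_K2 \<longleftrightarrow> {f u, f v} \<in> edges (induced G {a, b, c, d})"
    if "u \<in> {0, 1, 2, 3}" "v \<in> {0, 1, 2, 3}" for u v
    using that assms(3-8) loops
    by (auto simp: two_K2_def induced_def f_def doubleton_eq_iff insert_commute)
  ultimately have "graph_iso two_K2 (induced G {a, b, c, d})"
    unfolding graph_iso_def by (intro exI[of _ f]) (auto simp: two_K2_def induced_def)
  then show ?thesis
    using assms(1) unfolding contains_induced_def by blast
qed

lemma contains_induced_two_K2E:
  assumes "contains_induced G two_K2"
  obtains a b c d where "{a, b} \<in> edges G" "{c, d} \<in> edges G"
    "{a, c} \<notin> edges G" "{a, d} \<notin> edges G" "{b, c} \<notin> edges G" "{b, d} \<notin> edges G"
proof -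
  obtain U where "graph_iso two_K2 (induced G U)"
    using assms unfolding contains_induced_def by blast
  then obtain f where bij: "bij_betw f (verts two_K2) U"
    and iff: "\<forall>u\<in>verts two_K2. \<forall>v\<in>verts two_K2.
      {u, v} \<in> edges two_K2 \<longleftrightarrow> {f u, f v} \<in> edges (induced G U)"
    unfolding graph_iso_def induced_def by auto
  have iff': "{f u, f v} \<in> edges G \<longleftrightarrow> {u, v} \<in> {{0, 1}, {2, 3}}"
    if "u \<in> {0, 1, 2, 3}" "v \<in> {0, 1, 2, 3}" for u v
  proof -
    have uv: "u \<in> verts two_K2" "v \<in> verts two_K2"
      using that by (simp_all add: two_K2_def)
    then have "{f u, f v} \<subseteq> U"
      using bij_betwE[OF bij] by blast
    then show ?thesis
      using iff[rule_format, OF uv] by (simp add: two_K2_def induced_def)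
  qed
  show thesis
    by (rule that[of "f 0" "f 1" "f 2" "f 3"]; subst iff') (auto simp: doubleton_eq_iff)
qed

text \<open>The hypothesis says that the sets \<open>{v. R u v}\<close> form a chain under
  inclusion, so any two edges are joined by a further edge, which an induced \<open>two_K2\<close>
  forbids.\<close>

lemma Ferrers_relation_no_two_K2:
  assumes "\<And>u v u' v'. R u v \<Longrightarrow> R u' v' \<Longrightarrow> R u v' \<or> R u' v"
  shows "\<not> contains_induced \<lparr>verts = V, edges = {{u, v} | u v. R u v}\<rparr> two_K2"
proof
  let ?E = "{{u, v} | u v. R u v}"
  assume "contains_induced \<lparr>verts = V, edges = ?E\<rparr> two_K2"
  then obtain a b c d where E: "{a, b} \<in> ?E" "{c, d} \<in> ?E"
    and notE: "{a, c} \<notin> ?E" "{a, d} \<notin> ?E" "{b, c} \<notin> ?E" "{b, d} \<notin> ?E"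
    by (rule contains_induced_two_K2E) simp_all
  have cross: "\<not> R x y \<and> \<not> R y x" if "x \<in> {a, b}" "y \<in> {c, d}" for x y
    using that notE by (auto simp: insert_commute)
  obtain u v u' v' where "{a, b} = {u, v}" "R u v" "{c, d} = {u', v'}" "R u' v'"
    using E by blast
  then show False
    using assms[of u v u' v'] cross[of u v'] cross[of v u'] by blast
qed

lemma bipartiteE:
  assumes "bipartite G"
  obtains A B where "A \<union> B = verts G" "A \<inter> B = {}"
    "\<And>e. e \<in> edges G \<Longrightarrow> \<exists>a\<in>A. \<exists>b\<in>B. e = {a, b}"
  using assms unfolding bipartite_def by (elim exE conjE) (rule that, assumption+, rule bspec)

section \<open>The upper bound\<close>

text \<open>Each part is encoded by orienting its edges from one colour class to the other. By
  \<open>sides\<close> no head is also a tail, which gives bipartiteness and excludes loops;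
  \<open>unique\<close> tests both orientations because edges are unordered.\<close>

lemma chi_index_complete_le:
  fixes R :: "nat \<Rightarrow> nat \<Rightarrow> nat \<Rightarrow> bool"
  assumes Ferrers: "\<And>i u v u' v'. R i u v \<Longrightarrow> R i u' v' \<Longrightarrow> R i u v' \<or> R i u' v"
    and sides: "\<And>i u v w. R i u v \<Longrightarrow> \<not> R i v w"
    and bound: "\<And>i u v. R i u v \<Longrightarrow> u < n \<and> v < n"
    and cover: "\<And>u v. u < v \<Longrightarrow> v < n \<Longrightarrow> \<exists>i<k. R i u v \<or> R i v u"
    and unique: "\<And>i j u v. R i u v \<Longrightarrow> R j u v \<or> R j v u \<Longrightarrow> i = j"
  shows "chi_index_complete {two_K2} n \<le> k"
proof -
  define P where "P i = \<lparr>verts = {..<n}, edges = {{u, v} | u v. R i u v}\<rparr>" for i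
  have neq: "u \<noteq> v" if "R i u v" for i u v
    using sides that by blast
  have "subgraph (P i) (complete_graph n)" for i
    using bound[of i] neq[of i]
    by (auto simp: subgraph_def simple_graph_def P_def complete_graph_def)
  moreover have "bipartite (P i)" for i
    unfolding bipartite_def
  proof (intro exI conjI)
    let ?A = "{u. \<exists>v. R i u v}"
    show "?A \<union> ({..<n} - ?A) = verts (P i)"
      using bound by (auto simp: P_def)
    show "\<forall>e\<in>edges (P i). \<exists>a\<in>?A. \<exists>b\<in>{..<n} - ?A. e = {a, b}"
      using bound[of i] sides[of i] by (fastforce simp: P_def)
  qed blast
  moreover have "edges (P i) \<inter> edges (P j) = {}" if "i \<noteq> j" for i j
  proof -
    have "\<not> R j u' v'" if "R i u v" "{u, v} = {u', v'}" for u v u' v'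
      using that unique[of i u v j] \<open>i \<noteq> j\<close> by (auto simp: doubleton_eq_iff)
    then show ?thesis
      unfolding P_def by auto
  qed
  moreover have "(\<Union>i<k. edges (P i)) = edges (complete_graph n)"
  proof
    show "(\<Union>i<k. edges (P i)) \<subseteq> edges (complete_graph n)"
      using \<open>\<And>i. subgraph (P i) (complete_graph n)\<close> by (auto simp: subgraph_def)
    show "edges (complete_graph n) \<subseteq> (\<Union>i<k. edges (P i))"
    proof
      fix e assume "e \<in> edges (complete_graph n)"
      then obtain a b where "e = {a, b}" "a \<noteq> b" "a < n" "b < n"
        by (auto simp: complete_graph_def card_2_iff)
      then obtain u v where "e = {u, v}" "u < v" "v < n"
        by (metis insert_commute linorder_neqE_nat)
      then show "e \<in> (\<Union>i<k. edges (P i))"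
        using cover[of u v] by (auto simp: P_def)
    qed
  qed
  moreover have "\<not> contains_induced (P i) two_K2" for i
    unfolding P_def using Ferrers by (intro Ferrers_relation_no_two_K2)
  ultimately have "avoiding_bipartite_partition {two_K2} (complete_graph n) k P"
    by (simp add: avoiding_bipartite_partition_def)
  then show ?thesis
    unfolding chi_index_complete_def chi_index_def by (intro Least_le) blast
qed

lemma chi_index_complete_two_K2_le:
  assumes "n \<le> m\<^sup>2"
  shows "chi_index_complete {two_K2} n \<le> 2 * (m - 1)"
proof -
  \<comment> \<open>The column of a point is its quotient by \<open>m\<close>, its height the
    remainder. Indices below \<open>m - 1\<close> stand for columns, the next \<open>m - 1\<close>
    for rows; the last column and the top row have nothing beyond them and need no graph.\<close>
  define R where "R i u v \<longleftrightarrow> u < n \<and> v < n \<and>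
    (if i < m - 1 then u div m = i \<and> i < v div m \<and> u mod m \<le> v mod m
     else u mod m + (m - 1) = i \<and> u mod m < v mod m \<and> v div m \<le> u div m)" for i u v
  have div_less: "u div m < m" if "u < n" for u
    using that assms by (simp add: less_mult_imp_div_less power2_eq_square)
  have mod_less: "u mod m < m" if "u < n" for u
    using that assms by (cases "m = 0") auto
  show ?thesis
  proof (rule chi_index_complete_le[of R])
    show "R i u v' \<or> R i u' v" if "R i u v" "R i u' v'" for i u v u' v'
      using that unfolding R_def by (auto split: if_splits)
    show "\<not> R i v w" if "R i u v" for i u v w
      using that unfolding R_def by (auto split: if_splits)
    show "u < n \<and> v < n" if "R i u v" for i u v
      using that unfolding R_def by blast
    show "\<exists>i<2 * (m - 1). R i u v \<or> R i v u" if "u < v" "v < n" for u v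
    proof -
      have uv: "u div m < m" "v div m < m" "u mod m < m" "v mod m < m"
        using that div_less mod_less by simp_all
      have le: "u div m \<le> v div m"
        using that by (simp add: div_le_mono)
      have neq: "u mod m \<noteq> v mod m" if "u div m = v div m"
        using that \<open>u < v\<close> by (metis div_mult_mod_eq less_irrefl)
      \<comment> \<open>The edge belongs to the column of \<open>u\<close>, the row of
        \<open>v\<close> and the row of \<open>u\<close>, respectively.\<close>
      consider "u div m < v div m" "u mod m \<le> v mod m" | "v mod m < u mod m" "u div m \<le> v div m"
        | "u div m = v div m" "u mod m < v mod m"
        using le neq by linarith
      then show ?thesis
      proof cases
        case 1
        then show ?thesis
          using that uv by (intro exI[of _ "u div m"]) (auto simp: R_def)
      next
        case 2
        moreover have "v mod m < m - 1"
          using 2 uv by linarith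
        ultimately show ?thesis
          using that by (intro exI[of _ "v mod m + (m - 1)"]) (auto simp: R_def)
      next
        case 3
        moreover have "u mod m < m - 1"
          using 3 uv by linarith
        ultimately show ?thesis
          using that by (intro exI[of _ "u mod m + (m - 1)"]) (auto simp: R_def)
      qed
    qed
    show "i = j" if "R i u v" "R j u v \<or> R j v u" for i j u v
      using that unfolding R_def by (auto split: if_splits)
  qed
qed

section \<open>Small vertex covers of Ferrers graphs\<close>

text \<open>If neither neighbourhood contains the other, private neighbours \<open>b\<close> and
  \<open>b'\<close> give two edges without cross edges; pairs inside a colour class are never edges,
  so this is an induced \<open>two_K2\<close>.\<close>

lemma two_K2_free_neighbourhoods_chain:
  assumes "simple_graph G" "\<not> contains_induced G two_K2"
    and "A \<inter> B = {}" "\<And>e. e \<in> edges G \<Longrightarrow> \<exists>a\<in>A. \<exists>b\<in>B. e = {a, b}"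
    and "a \<in> A" "a' \<in> A"
  shows "{b \<in> B. {a, b} \<in> edges G} \<subseteq> {b \<in> B. {a', b} \<in> edges G} \<or>
         {b \<in> B. {a', b} \<in> edges G} \<subseteq> {b \<in> B. {a, b} \<in> edges G}"
proof (rule ccontr)
  assume "\<not> ?thesis"
  then obtain b b' where b: "b \<in> B" "{a, b} \<in> edges G" "{a', b} \<notin> edges G"
    and b': "b' \<in> B" "{a', b'} \<in> edges G" "{a, b'} \<notin> edges G"
    by blast
  have "{a, b, a', b'} \<subseteq> verts G"
    using b b' assms(1) by (auto simp: simple_graph_def)
  moreover have "distinct [a, b, a', b']"
    using b b' assms(3,5,6) by auto
  moreover have "{a, a'} \<notin> edges G" "{b, b'} \<notin> edges G"
    using assms(3,4,5,6) b(1) b'(1) by (fastforce simp: doubleton_eq_iff)+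
  ultimately have "contains_induced G two_K2"
    using contains_induced_two_K2I[OF _ _ b(2) b'(2) _ b'(3)] b(3) assms(1)
    by (simp add: insert_commute)
  with assms(2) show False by contradiction
qed

text \<open>The cover consists of the vertices of \<open>A\<close> of degree above \<open>p\<close>
  and all neighbours of the remaining ones. Each set has at most \<open>p\<close> elements, while
  the graph has at least \<open>p * p\<close> edges.\<close>

lemma two_K2_free_vertex_cover:
  assumes "simple_graph G" "finite (verts G)" "bipartite G" "\<not> contains_induced G two_K2"
  obtains C where "C \<subseteq> verts G" "\<And>e. e \<in> edges G \<Longrightarrow> e \<inter> C \<noteq> {}" "(card C)\<^sup>2 \<le> 4 * card (edges G)"
proof (rule bipartiteE[OF assms(3)])
  fix A B
  assume AB: "A \<union> B = verts G" "A \<inter> B = {}"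
    and E: "\<And>e. e \<in> edges G \<Longrightarrow> \<exists>a\<in>A. \<exists>b\<in>B. e = {a, b}"
  have fin: "finite A" "finite B"
    using assms(2) unfolding AB(1)[symmetric] by simp_all
  have "edges G \<subseteq> Pow (verts G)"
    using assms(1) by (auto simp: simple_graph_def)
  then have "finite (edges G)"
    using assms(2) by (simp add: finite_subset)
  define N where "N a = {b \<in> B. {a, b} \<in> edges G}" for a
  have finN: "finite (N a)" for a
    using fin by (simp add: N_def)
  have chain: "N a \<subseteq> N a' \<or> N a' \<subseteq> N a" if "a \<in> A" "a' \<in> A" for a a'
    unfolding N_def using two_K2_free_neighbourhoods_chain[OF assms(1,4) AB(2) E that] .
  \<comment> \<open>\<open>p\<close> is the side of the Durfee square.\<close>
  define p where "p = (LEAST p. card {a \<in> A. p < card (N a)} \<le> p)"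
  define X where "X = {a \<in> A. p < card (N a)}"
  define Y where "Y = (\<Union>a\<in>A - X. N a)"
  \<comment> \<open>The value \<open>card A\<close> shows that the \<open>LEAST\<close> defining
    \<open>p\<close> is attained.\<close>
  have "card {a \<in> A. card A < card (N a)} \<le> card A"
    using fin by (intro card_mono) auto
  then have X: "card X \<le> p"
    unfolding X_def p_def by (rule LeastI)
  have Y: "card Y \<le> p"
  proof (cases "A - X = {}")
    case True
    then show ?thesis
      unfolding Y_def True by simp
  next
    case False
    \<comment> \<open>By the chain property, a vertex of largest degree outside \<open>X\<close> has
      a neighbourhood containing all the others, so \<open>Y\<close> is a single
      neighbourhood.\<close>
    define D where "D = (\<lambda>a. card (N a)) ` (A - X)"
    have "finite D" "D \<noteq> {}"
      using fin False by (auto simp: D_def)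
    then obtain a where a: "a \<in> A - X" "card (N a) = Max D"
      using Max_in[of D] unfolding D_def by (metis imageE)
    have max: "card (N a') \<le> card (N a)" if "a' \<in> A - X" for a'
      unfolding a(2) using \<open>finite D\<close> that by (intro Max_ge) (auto simp: D_def)
    have "N a' \<subseteq> N a" if "a' \<in> A - X" for a'
      using chain[of a a'] a(1) that card_seteq[OF finN _ max[OF that]] by blast
    then have "Y = N a"
      using a(1) unfolding Y_def by blast
    then show ?thesis
      using a(1) by (auto simp: X_def)
  qed
  have square: "p\<^sup>2 \<le> card (edges G)"
  \<comment> \<open>For \<open>p = Suc q\<close>, minimality rules out \<open>q\<close>, so at least
    \<open>p\<close> vertices have degree at least \<open>p\<close>.\<close>
  proof (cases p)
    case (Suc q)
    define Z where "Z = {a \<in> A. q < card (N a)}"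
    have "q < card Z"
      using Suc not_less_Least[of q "\<lambda>p. card {a \<in> A. p < card (N a)} \<le> p"]
      unfolding p_def[symmetric] Z_def by simp
    have "p\<^sup>2 \<le> card Z * p"
      unfolding power2_eq_square using Suc \<open>q < card Z\<close> by (intro mult_right_mono) simp_all
    also have "\<dots> = (\<Sum>a\<in>Z. p)"
      by simp
    also have "\<dots> \<le> (\<Sum>a\<in>Z. card (N a))"
      using Suc by (intro sum_mono) (auto simp: Z_def)
    also have "\<dots> = card (Sigma Z N)"
      using fin finN by (simp add: Z_def)
    also have "\<dots> \<le> card (edges G)"
    proof (rule card_inj_on_le)
      show "inj_on (\<lambda>(a, b). {a, b}) (Sigma Z N)"
        using AB(2) by (auto simp: inj_on_def Z_def N_def doubleton_eq_iff)
      show "(\<lambda>(a, b). {a, b}) ` Sigma Z N \<subseteq> edges G"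
        by (auto simp: N_def)
    qed fact
    finally show ?thesis .
  qed simp
  show thesis
  proof (rule that[of "X \<union> Y"])
    show "X \<union> Y \<subseteq> verts G"
      using AB(1) by (auto simp: X_def Y_def N_def)
    show "e \<inter> (X \<union> Y) \<noteq> {}" if e: "e \<in> edges G" for e
    proof -
      obtain a b where "a \<in> A" "b \<in> N a" "e = {a, b}"
        using E[OF e] e by (auto simp: N_def)
      then show ?thesis
        unfolding Y_def by blast
    qed
    have "card (X \<union> Y) \<le> 2 * p"
      using card_Un_le[of X Y] X Y by linarith
    then have "(card (X \<union> Y))\<^sup>2 \<le> (2 * p)\<^sup>2"
      by (rule power_mono) simp
    then show "(card (X \<union> Y))\<^sup>2 \<le> 4 * card (edges G)"
      using square by (simp add: power_mult_distrib)
  qed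
qed

section \<open>The lower bound\<close>

text \<open>This is the expansion of the product \<open>(2 + 1) ^ card K\<close> over
  subsets.\<close>

lemma sum_Pow_two_power_card:
  assumes "finite K"
  shows "(\<Sum>R\<in>Pow K. 2 ^ card R) = (3 :: nat) ^ card K"
  using prod_add[OF assms, of "\<lambda>_. 2" "\<lambda>_. 1 :: nat"] by simp

lemma card_supersets_within:
  assumes "finite K" "T \<subseteq> K"
  shows "card {R \<in> Pow K. T \<subseteq> R} = 2 ^ (card K - card T)"
proof -
  have "bij_betw ((\<union>) T) (Pow (K - T)) {R \<in> Pow K. T \<subseteq> R}"
    by (rule bij_betwI[where g = "\<lambda>R. R - T"]) (use assms(2) in auto)
  then have "card {R \<in> Pow K. T \<subseteq> R} = card (Pow (K - T))"
    by (metis bij_betw_same_card)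
  then show ?thesis
    using assms by (simp add: card_Pow card_Diff_subset finite_subset)
qed

text \<open>Jensen's inequality through the tangent line at \<open>a\<close>. An upper bound on the
  mean is enough because \<open>exp (- c * t)\<close> does not increase with
  \<open>t\<close>.\<close>

lemma sum_exp_ge:
  fixes t :: "'a \<Rightarrow> real" and a c :: real
  assumes "finite V" "c \<ge> 0" "sum t V \<le> card V * a"
  shows "card V * exp (- c * a) \<le> (\<Sum>v\<in>V. exp (- c * t v))"
proof -
  have "card V * exp (- c * a) \<le> exp (- c * a) * (card V + c * (card V * a - sum t V))"
    using mult_nonneg_nonneg[OF assms(2), of "card V * a - sum t V"] assms(3)
    by (simp add: mult.commute mult_left_mono)
  also have "\<dots> = (\<Sum>v\<in>V. exp (- c * a) * (1 + c * (a - t v)))"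
    by (simp add: sum_distrib_left[symmetric] sum.distrib sum_subtractf)
  also have "\<dots> \<le> (\<Sum>v\<in>V. exp (- c * a) * exp (c * (a - t v)))"
    by (intro sum_mono mult_left_mono exp_ge_add_one_self) simp
  also have "\<dots> = (\<Sum>v\<in>V. exp (- c * t v))"
    by (simp add: exp_add[symmetric] algebra_simps)
  finally show ?thesis .
qed

text \<open>\<open>S v\<close> records the bipartitions having \<open>v\<close> on their first side,
  \<open>T v\<close> the covers containing \<open>v\<close>. The graph containing the edge
  \<open>{u, v}\<close> separates \<open>u\<close> from \<open>v\<close>, and its index lies in
  \<open>T u \<union> T v\<close> because its cover meets that edge.\<close>

lemma avoiding_bipartite_partition_separates:
  assumes "avoiding_bipartite_partition {two_K2} (complete_graph n) k P"
  obtains S T where "\<And>v. T v \<subseteq> {..<k}" "(\<Sum>v<n. card (T v))\<^sup>2 \<le> 2 * k * n\<^sup>2"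
    "\<And>R. inj_on (\<lambda>v. S v \<inter> R) {v. v < n \<and> T v \<subseteq> R}"
proof -
  have P: "subgraph (P i) (complete_graph n)" "bipartite (P i)" "\<not> contains_induced (P i) two_K2"
    if "i < k" for i
    using assms that by (auto simp: avoiding_bipartite_partition_def)
  have disj: "edges (P i) \<inter> edges (P j) = {}" if "i < k" "j < k" "i \<noteq> j" for i j
    using assms that by (auto simp: avoiding_bipartite_partition_def)
  have union: "(\<Union>i<k. edges (P i)) = edges (complete_graph n)"
    using assms by (auto simp: avoiding_bipartite_partition_def)
  have "\<forall>i<k. \<exists>C. C \<subseteq> {..<n} \<and> (\<forall>e\<in>edges (P i). e \<inter> C \<noteq> {}) \<and> (card C)\<^sup>2 \<le> 4 * card (edges (P i))"
  proof (intro allI impI)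
    fix i assume "i < k"
    note Pi = P[OF this]
    then have sub: "verts (P i) \<subseteq> {..<n}" and "simple_graph (P i)"
      by (simp_all add: subgraph_def complete_graph_def)
    then obtain C where "C \<subseteq> verts (P i)" "\<And>e. e \<in> edges (P i) \<Longrightarrow> e \<inter> C \<noteq> {}"
      "(card C)\<^sup>2 \<le> 4 * card (edges (P i))"
      using two_K2_free_vertex_cover[of "P i"] Pi finite_subset by blast
    with sub show "\<exists>C. C \<subseteq> {..<n} \<and> (\<forall>e\<in>edges (P i). e \<inter> C \<noteq> {}) \<and> (card C)\<^sup>2 \<le> 4 * card (edges (P i))"
      by blast
  qed
  then obtain C where C: "\<And>i. i < k \<Longrightarrow> C i \<subseteq> {..<n}"
    "\<And>i e. i < k \<Longrightarrow> e \<in> edges (P i) \<Longrightarrow> e \<inter> C i \<noteq> {}"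
    "\<And>i. i < k \<Longrightarrow> (card (C i))\<^sup>2 \<le> 4 * card (edges (P i))"
    by metis
  have "\<forall>i<k. \<exists>A. \<forall>u v. {u, v} \<in> edges (P i) \<longrightarrow> (u \<in> A) \<noteq> (v \<in> A)"
  proof (intro allI impI)
    fix i assume "i < k"
    then obtain A B where AB: "A \<inter> B = {}"
      and E: "\<And>e. e \<in> edges (P i) \<Longrightarrow> \<exists>a\<in>A. \<exists>b\<in>B. e = {a, b}"
      using bipartiteE[OF P(2)] by metis
    have "(u \<in> A) \<noteq> (v \<in> A)" if uv: "{u, v} \<in> edges (P i)" for u v
    proof -
      obtain a b where "a \<in> A" "b \<in> B" "{u, v} = {a, b}"
        using E[OF uv] by blast
      then show ?thesis
        using AB by (auto simp: doubleton_eq_iff)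
    qed
    then show "\<exists>A. \<forall>u v. {u, v} \<in> edges (P i) \<longrightarrow> (u \<in> A) \<noteq> (v \<in> A)"
      by blast
  qed
  then obtain A where A: "\<And>i u v. i < k \<Longrightarrow> {u, v} \<in> edges (P i) \<Longrightarrow> (u \<in> A i) \<noteq> (v \<in> A i)"
    by metis
  define S where "S v = {i. v \<in> A i}" for v
  define T where "T v = {i. i < k \<and> v \<in> C i}" for v
  show thesis
  proof (rule that[of T S])
    show "T v \<subseteq> {..<k}" for v
      by (auto simp: T_def)
    show "inj_on (\<lambda>v. S v \<inter> R) {v. v < n \<and> T v \<subseteq> R}" for R
    proof (rule inj_onI, rule ccontr)
      fix u v assume u: "u \<in> {v. v < n \<and> T v \<subseteq> R}" and v: "v \<in> {v. v < n \<and> T v \<subseteq> R}"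
        and eq: "S u \<inter> R = S v \<inter> R" and "u \<noteq> v"
      then have "{u, v} \<in> edges (complete_graph n)"
        by (simp add: complete_graph_def)
      then obtain i where i: "i < k" "{u, v} \<in> edges (P i)"
        using union by blast
      have "i \<in> T u \<union> T v"
        using C(2)[OF i] i(1) by (auto simp: T_def)
      then have "i \<in> R"
        using u v by blast
      then show False
        using A[OF i] eq by (auto simp: S_def)
    qed
    \<comment> \<open>Double counting of the incidences between vertices and covers.\<close>
    have "(\<Sum>v<n. card (T v)) = (\<Sum>v<n. \<Sum>i<k. if v \<in> C i then 1 else 0)"
      by (simp add: T_def sum.If_cases Int_def)
    also have "\<dots> = (\<Sum>i<k. \<Sum>v<n. if v \<in> C i then 1 else 0)"
      by (rule sum.swap)
    also have "\<dots> = (\<Sum>i<k. card (C i))"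
      using C(1) by (intro sum.cong) (auto simp: sum.If_cases Int_absorb1)
    finally have sum_T: "(\<Sum>v<n. card (T v)) = (\<Sum>i<k. card (C i))" .
    have E: "edges (complete_graph n) = {e. e \<subseteq> {..<n} \<and> card e = 2}"
      by (simp add: complete_graph_def)
    have finE: "finite (edges (complete_graph n))"
      unfolding E by (rule finite_subset[of _ "Pow {..<n}"]) auto
    have "finite (edges (P i))" if "i < k" for i
      using union finE that by (metis UN_upper finite_subset lessThan_iff)
    then have "2 * (\<Sum>i<k. card (edges (P i))) = 2 * card (\<Union>i<k. edges (P i))"
      using disj by (subst card_UN_disjoint) auto
    also have "\<dots> = 2 * (n choose 2)"
      unfolding union E using n_subsets[of "{..<n}" 2] by simp
    also have "\<dots> \<le> n * (n - 1)"
      by (simp add: choose_two)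
    also have "\<dots> \<le> n\<^sup>2"
      by (simp add: power2_eq_square)
    finally have "2 * (\<Sum>i<k. card (edges (P i))) \<le> n\<^sup>2" .
    moreover have "(\<Sum>i<k. (card (C i))\<^sup>2) \<le> 4 * (\<Sum>i<k. card (edges (P i)))"
      unfolding sum_distrib_left by (intro sum_mono C(3)) simp
    ultimately have *: "(\<Sum>i<k. (card (C i))\<^sup>2) \<le> 2 * n\<^sup>2"
      by linarith
    have "real ((\<Sum>i<k. card (C i))\<^sup>2) \<le> real ((\<Sum>i<k. (card (C i))\<^sup>2) * k)"
      using sum_squared_le_sum_of_squares[of "\<lambda>i. real (card (C i))" "{..<k}"] by simp
    then have "(\<Sum>i<k. card (C i))\<^sup>2 \<le> (\<Sum>i<k. (card (C i))\<^sup>2) * k"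
      by (simp only: of_nat_le_iff)
    also have "\<dots> \<le> 2 * n\<^sup>2 * k"
      using * by (rule mult_right_mono) simp
    finally show "(\<Sum>v<n. card (T v))\<^sup>2 \<le> 2 * k * n\<^sup>2"
      by (simp add: sum_T ac_simps)
  qed
qed

lemma log_le_of_avoiding_bipartite_partition:
  assumes "avoiding_bipartite_partition {two_K2} (complete_graph n) k P" "n > 0"
  shows "log 2 n \<le> k \<and> log 2 n \<le> 3 / 5 * k + sqrt (2 * real k)"
proof (rule avoiding_bipartite_partition_separates[OF assms(1)])
  fix S T :: "nat \<Rightarrow> nat set"
  assume T: "\<And>v. T v \<subseteq> {..<k}" and sum_T: "(\<Sum>v<n. card (T v))\<^sup>2 \<le> 2 * k * n\<^sup>2"
    and inj: "\<And>R. inj_on (\<lambda>v. S v \<inter> R) {v. v < n \<and> T v \<subseteq> R}"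
  have count: "card {v. v < n \<and> T v \<subseteq> R} \<le> 2 ^ card R" if "finite R" for R
    using card_inj_on_le[OF inj, of R "Pow R"] that by (auto simp: card_Pow)
  \<comment> \<open>With \<open>R = {..<k}\<close> every vertex is counted.\<close>
  have "n \<le> 2 ^ k"
    using count[of "{..<k}"] T by simp
  then have "real n \<le> 2 ^ k"
    by (metis of_nat_le_iff of_nat_numeral of_nat_power)
  then have log_le: "log 2 n \<le> k"
    using assms(2) by (simp add: log_le_iff powr_realpow)
  have finT: "card (T v) \<le> k" for v
    using card_mono[OF _ T] by simp
  \<comment> \<open>Counts the pairs \<open>(v, R)\<close> with \<open>T v \<subseteq> R\<close>,
    first by \<open>v\<close> and then by \<open>R\<close>.\<close>
  have "(\<Sum>v<n. 2 ^ (k - card (T v))) = (\<Sum>v<n. card {R \<in> Pow {..<k}. T v \<subseteq> R})"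
    using T by (intro sum.cong) (simp_all only: card_supersets_within finite_lessThan card_lessThan)
  also have "\<dots> = (\<Sum>v<n. \<Sum>R\<in>Pow {..<k}. if T v \<subseteq> R then 1 else 0)"
    by (simp add: sum.If_cases Int_def)
  also have "\<dots> = (\<Sum>R\<in>Pow {..<k}. \<Sum>v<n. if T v \<subseteq> R then 1 else 0)"
    by (rule sum.swap)
  also have "\<dots> = (\<Sum>R\<in>Pow {..<k}. card {v. v < n \<and> T v \<subseteq> R})"
    by (simp add: sum.If_cases Int_def)
  also have "\<dots> \<le> (\<Sum>R\<in>Pow {..<k}. 2 ^ card R)"
    by (intro sum_mono count) (auto intro: finite_subset)
  also have "\<dots> = 3 ^ k"
    by (simp add: sum_Pow_two_power_card)
  finally have "real (\<Sum>v<n. 2 ^ (k - card (T v))) \<le> 3 ^ k"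
    by (metis of_nat_le_iff of_nat_numeral of_nat_power)
  moreover have "(2 :: real) ^ (k - card (T v)) = 2 ^ k * exp (- ln 2 * card (T v))" for v
    using finT[of v] by (simp add: power_diff exp_minus exp_of_nat2_mult divide_inverse)
  ultimately have upper: "2 ^ k * (\<Sum>v<n. exp (- ln 2 * card (T v))) \<le> 3 ^ k"
    by (simp add: sum_distrib_left)
  have "real ((\<Sum>v<n. card (T v))\<^sup>2) \<le> real (2 * k * n\<^sup>2)"
    using sum_T by (simp only: of_nat_le_iff)
  then have "(\<Sum>v<n. real (card (T v)))\<^sup>2 \<le> 2 * real k * (real n)\<^sup>2"
    by simp
  then have "(\<Sum>v<n. real (card (T v))) \<le> sqrt (2 * real k * (real n)\<^sup>2)"
    by (rule real_le_rsqrt)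
  then have "(\<Sum>v<n. real (card (T v))) \<le> real (card {..<n}) * sqrt (2 * real k)"
    by (simp add: real_sqrt_mult ac_simps)
  then have "n * exp (- ln 2 * sqrt (2 * real k)) \<le> (\<Sum>v<n. exp (- ln 2 * card (T v)))"
    using sum_exp_ge[of "{..<n}" "ln 2"] by simp
  then have "2 ^ k * (n * exp (- ln 2 * sqrt (2 * real k))) \<le> 3 ^ k"
    using upper by (meson mult_left_mono order_trans zero_le_numeral zero_le_power)
  then have "ln (2 ^ k * (n * exp (- ln 2 * sqrt (2 * real k)))) \<le> ln (3 ^ k)"
    using assms(2) by (subst ln_le_cancel_iff) auto
  then have "k * ln 2 + ln n - ln 2 * sqrt (2 * real k) \<le> k * ln 3"
    using assms(2) by (simp add: ln_mult ln_realpow)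
  \<comment> \<open>From \<open>243 \<le> 256\<close>; hence
    \<open>log 2 (3 / 2) \<le> 3 / 5\<close>, the coefficient in the claim.\<close>
  moreover have "5 * ln 3 \<le> 8 * ln (2 :: real)"
  proof -
    have "ln (3 ^ 5) \<le> ln (2 ^ 8 :: real)"
      by simp
    then show ?thesis
      by (simp only: ln_realpow zero_less_numeral of_nat_numeral)
  qed
  then have "k * (5 * ln 3) \<le> k * (8 * ln (2 :: real))"
    by (rule mult_left_mono) simp
  ultimately have "ln n \<le> (3 / 5 * k + sqrt (2 * real k)) * ln 2"
    by (simp add: algebra_simps)
  then have "log 2 n \<le> 3 / 5 * k + sqrt (2 * real k)"
    by (simp add: log_def divide_le_eq)
  with log_le show ?thesis ..
qed

text \<open>For \<open>L < 16\<close> the correction \<open>1 / 4 * sqrt L - 1\<close> is negative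
  and \<open>L \<le> k\<close> suffices. Otherwise the third hypothesis leaves a quadratic
  inequality in \<open>sqrt k \<ge> 4\<close>.\<close>

lemma sqrt_correction_bound:
  fixes L k :: real
  assumes "0 \<le> L" "L \<le> k" "L \<le> 3 / 5 * k + sqrt (2 * k)"
  shows "L + 1 / 4 * sqrt L - 1 < k"
proof (cases "L < 16")
  case True
  then have "sqrt L < sqrt (4\<^sup>2)"
    by (intro real_sqrt_less_mono) simp
  then show ?thesis
    using assms(2) by simp
next
  case False
  define q where "q = sqrt k"
  have "sqrt (4\<^sup>2) \<le> q"
    unfolding q_def using False assms(2) by (intro real_sqrt_le_mono) simp
  then have q: "4 \<le> q"
    by simp
  have k: "k = q * q"
    using False assms(2) by (simp add: q_def)
  have "sqrt 2 \<le> 283 / 200"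
    by (rule real_le_lsqrt) (simp_all add: power2_eq_square)
  then have "sqrt 2 * q \<le> 283 / 200 * q"
    using q by (intro mult_right_mono) auto
  moreover have "sqrt L \<le> q"
    using assms(2) by (simp add: q_def)
  moreover have "L \<le> 3 / 5 * (q * q) + sqrt 2 * q"
    using assms(3) by (simp add: real_sqrt_mult q_def k[unfolded q_def, symmetric])
  \<comment> \<open>Here \<open>333 / 200 = 283 / 200 + 1 / 4\<close>. The factor with root
    \<open>4\<close> is chosen to match the quadratic and linear terms of the goal; the constant
    \<open>13 / 50\<close> is below the available \<open>1\<close>.\<close>
  moreover have "0 \<le> (q - 4) * (2 / 5 * q - 13 / 200)"
    using q by simp
  moreover have "(q - 4) * (2 / 5 * q - 13 / 200) = 2 / 5 * (q * q) - 333 / 200 * q + 13 / 50"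
    by (simp add: field_simps)
  ultimately show ?thesis
    unfolding k by linarith
qed

theorem mainTheorem1:
  fixes n :: nat
  assumes "n > 0"
  shows "of_int \<lfloor>log 2 (real n)\<rfloor> + 1 / 4 * sqrt (of_int \<lfloor>log 2 (real n)\<rfloor>) - 1
           < real (chi_index_complete {two_K2} n)
       \<and> int (chi_index_complete {two_K2} n) \<le> 2 * \<lceil>sqrt (real n)\<rceil> - 2"
proof
  let ?k = "chi_index_complete {two_K2} n"
  \<comment> \<open>Existence of some partition ensures that the least number of parts is
    attained.\<close>
  obtain P where P: "avoiding_bipartite_partition {two_K2} (complete_graph n) ?k P"
    using LeastI_ex[OF ex_partition_2K2] unfolding chi_index_complete_def chi_index_def by blast
  have "real_of_int \<lfloor>log 2 (real n)\<rfloor> \<le> log 2 n"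
    by simp
  moreover have "0 \<le> log 2 n"
    using assms by simp
  ultimately show "of_int \<lfloor>log 2 (real n)\<rfloor> + 1 / 4 * sqrt (of_int \<lfloor>log 2 (real n)\<rfloor>) - 1 < real ?k"
    using log_le_of_avoiding_bipartite_partition[OF P assms]
    by (intro sqrt_correction_bound) (simp_all, linarith+)
  define m where "m = nat \<lceil>sqrt (real n)\<rceil>"
  have "0 < sqrt (real n)"
    using assms by simp
  \<comment> \<open>Since \<open>m \<ge> 1\<close>, the truncated \<open>2 * (m - 1)\<close> agrees
    with the integer expression in the goal.\<close>
  then have m: "int m = \<lceil>sqrt (real n)\<rceil>" "m \<ge> 1"
    unfolding m_def by linarith+
  have "sqrt (real n) \<le> real m"
    unfolding m_def by (rule real_nat_ceiling_ge)
  then have "real n \<le> real (m\<^sup>2)"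
    using sqrt_le_D[of "real n" "real m"] by simp
  then have "?k \<le> 2 * (m - 1)"
    by (intro chi_index_complete_two_K2_le) (simp only: of_nat_le_iff)
  then show "int ?k \<le> 2 * \<lceil>sqrt (real n)\<rceil> - 2"
    using m by linarith
qed

end
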